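(* The variety $\mathsf{C3DP}$ of c3dp-algebras is generated by the class of contract algebras $\{\mathbf{C(B)} : \mathbf{B} \text{ a Boolean algebra}\}$.
   Context: A dp-algebra (double p-algebra) is an algebra $(A;\wedge,\vee,\neg,D,0,1)$ of type $(2,2,1,1,0,0)$ such that $(A;\wedge,\vee,0,1)$ is a bounded distributive lattice; for every $a\in A$, $\neg a$ is the greatest $b\in A$ with $a\wedge b=0$; and for every $a\in A$, $Da$ is the smallest $b\in A$ with $a\vee b=1$. It is regular if $a\wedge Da\le b\vee\neg b$ for all $a,b\in A$. A three-valued dp-algebra is a regular dp-algebra satisfying $\neg x\vee\neg\neg x=1$ and $Dx\wedge DDx=0$. A c3dp-algebra (centred three-valued dp-algebra) is an algebra $(A;\wedge,\vee,\neg,D,0,c,1)$ such that $(A;\wedge,\vee,\neg,D,0,1)$ is a three-valued dp-algebra and the constant $c$ satisfies $\neg c=0$ and $Dc=1$. The class of c3dp-algebras is a variety, denoted $\mathsf{C3DP}$. For a Boolean algebra $\mathbf{B} = (B;\cap,\cup,',0,1)$, the contract algebra on $\mathbf{B}$ is $\mathbf{C(B)} = (C(B);\wedge,\vee,\neg,D,\bot,\gamma,\top)$ with universe $C(B) = \{(a,b) \in B\times B : a \cup b = 1\}$ and operations $(a,b)\wedge(c,d) = (a\cup c, b\cap d)$, $(a,b)\vee(c,d) = (a\cap c, b\cup d)$, $\neg(a,b) = (b,b')$, $D(a,b) = (a',a)$, $\bot = (1,0)$, $\gamma = (1,1)$, $\top=(0,1)$ (with $\bot,\gamma,\top$ interpreting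 $0,c,1$). A variety is generated by a class $K$ of algebras of its signature if it is the smallest variety containing $K$. *)

theory Defs
  imports Main
begin

section \<open>Lattices, Boolean algebras and centred three-valued dp-algebras\<close>

text \<open>
  Algebras are records with an explicit carrier, so that the algebras over one type can be
  collected into sets. The values of the operations outside the carrier are irrelevant.
\<close>

record 'a lattice_sig =
  carrier :: "'a set"
  meet :: "'a \<Rightarrow> 'a \<Rightarrow> 'a" (infixl "\<sqinter>\<index>" 70)
  join :: "'a \<Rightarrow> 'a \<Rightarrow> 'a" (infixl "\<squnion>\<index>" 65)
  zer :: 'a ("\<zero>\<index>")
  uni :: 'a ("\<one>\<index>")

record 'a dp_sig = "'a lattice_sig" +
  neg :: "'a \<Rightarrow> 'a" ("\<sim>\<index> _" [81] 80)
  dneg :: "'a \<Rightarrow> 'a" ("\<D>\<index> _" [81] 80)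

record 'a c3dp_sig = "'a dp_sig" +
  ctr :: 'a ("\<c>\<index>")

record 'a boolean_sig = "'a lattice_sig" +
  compl :: "'a \<Rightarrow> 'a"

definition leq :: "('a, 'm) lattice_sig_scheme \<Rightarrow> 'a \<Rightarrow> 'a \<Rightarrow> bool" (infix "\<sqsubseteq>\<index>" 50) where
  "x \<sqsubseteq>\<^bsub>A\<^esub> y \<longleftrightarrow> x \<sqinter>\<^bsub>A\<^esub> y = x"

locale bounded_distributive_lattice =
  fixes A :: "('a, 'm) lattice_sig_scheme" (structure)
  assumes zero_closed: "\<zero> \<in> carrier A"
    and one_closed: "\<one> \<in> carrier A"
    and meet_closed: "\<lbrakk>x \<in> carrier A; y \<in> carrier A\<rbrakk> \<Longrightarrow> x \<sqinter> y \<in> carrier A"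
    and join_closed: "\<lbrakk>x \<in> carrier A; y \<in> carrier A\<rbrakk> \<Longrightarrow> x \<squnion> y \<in> carrier A"
    and meet_comm: "\<lbrakk>x \<in> carrier A; y \<in> carrier A\<rbrakk> \<Longrightarrow> x \<sqinter> y = y \<sqinter> x"
    and join_comm: "\<lbrakk>x \<in> carrier A; y \<in> carrier A\<rbrakk> \<Longrightarrow> x \<squnion> y = y \<squnion> x"
    and meet_assoc: "\<lbrakk>x \<in> carrier A; y \<in> carrier A; z \<in> carrier A\<rbrakk>
          \<Longrightarrow> (x \<sqinter> y) \<sqinter> z = x \<sqinter> (y \<sqinter> z)"
    and join_assoc: "\<lbrakk>x \<in> carrier A; y \<in> carrier A; z \<in> carrier A\<rbrakk>
          \<Longrightarrow> (x \<squnion> y) \<squnion> z = x \<squnion> (y \<squnion> z)"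
    and meet_join_absorb: "\<lbrakk>x \<in> carrier A; y \<in> carrier A\<rbrakk> \<Longrightarrow> x \<sqinter> (x \<squnion> y) = x"
    and join_meet_absorb: "\<lbrakk>x \<in> carrier A; y \<in> carrier A\<rbrakk> \<Longrightarrow> x \<squnion> (x \<sqinter> y) = x"
    and meet_join_distrib: "\<lbrakk>x \<in> carrier A; y \<in> carrier A; z \<in> carrier A\<rbrakk>
          \<Longrightarrow> x \<sqinter> (y \<squnion> z) = (x \<sqinter> y) \<squnion> (x \<sqinter> z)"
    and zero_least: "x \<in> carrier A \<Longrightarrow> \<zero> \<sqsubseteq> x"
    and one_greatest: "x \<in> carrier A \<Longrightarrow> x \<sqsubseteq> \<one>"

text \<open>The one-element Boolean algebra is included.\<close>

locale boolean_alg = bounded_distributive_lattice A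
  for A :: "('a, 'm) boolean_sig_scheme" (structure) +
  assumes compl_closed: "x \<in> carrier A \<Longrightarrow> compl A x \<in> carrier A"
    and meet_compl: "x \<in> carrier A \<Longrightarrow> x \<sqinter> compl A x = \<zero>"
    and join_compl: "x \<in> carrier A \<Longrightarrow> x \<squnion> compl A x = \<one>"

locale dp_algebra = bounded_distributive_lattice A
  for A :: "('a, 'm) dp_sig_scheme" (structure) +
  assumes neg_closed: "x \<in> carrier A \<Longrightarrow> \<sim> x \<in> carrier A"
    and dneg_closed: "x \<in> carrier A \<Longrightarrow> \<D> x \<in> carrier A"
    and meet_neg: "x \<in> carrier A \<Longrightarrow> x \<sqinter> \<sim> x = \<zero>"
    and neg_greatest: "\<lbrakk>x \<in> carrier A; y \<in> carrier A; x \<sqinter> y = \<zero>\<rbrakk> \<Longrightarrow> y \<sqsubseteq> \<sim> x"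
    and join_dneg: "x \<in> carrier A \<Longrightarrow> x \<squnion> \<D> x = \<one>"
    and dneg_least: "\<lbrakk>x \<in> carrier A; y \<in> carrier A; x \<squnion> y = \<one>\<rbrakk> \<Longrightarrow> \<D> x \<sqsubseteq> y"

locale regular_dp_algebra = dp_algebra +
  assumes regular: "\<lbrakk>x \<in> carrier A; y \<in> carrier A\<rbrakk> \<Longrightarrow> x \<sqinter> \<D> x \<sqsubseteq> y \<squnion> \<sim> y"

locale three_valued_dp_algebra = regular_dp_algebra +
  assumes stone: "x \<in> carrier A \<Longrightarrow> \<sim> x \<squnion> \<sim> (\<sim> x) = \<one>"
    and dual_stone: "x \<in> carrier A \<Longrightarrow> \<D> x \<sqinter> \<D> (\<D> x) = \<zero>"

locale c3dp_algebra = three_valued_dp_algebra A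
  for A :: "('a, 'm) c3dp_sig_scheme" (structure) +
  assumes ctr_closed: "\<c> \<in> carrier A"
    and neg_ctr: "\<sim> \<c> = \<zero>"
    and dneg_ctr: "\<D> \<c> = \<one>"

definition C3DP :: "'a c3dp_sig set" where
  "C3DP = {A. c3dp_algebra A}"


section \<open>Contract algebras\<close>

definition contract_algebra :: "'b boolean_sig \<Rightarrow> ('b \<times> 'b) c3dp_sig" where
  "contract_algebra B = \<lparr>
     carrier = {(a, b). a \<in> carrier B \<and> b \<in> carrier B \<and> a \<squnion>\<^bsub>B\<^esub> b = \<one>\<^bsub>B\<^esub>},
     meet = (\<lambda>(a, b) (c, d). (a \<squnion>\<^bsub>B\<^esub> c, b \<sqinter>\<^bsub>B\<^esub> d)),
     join = (\<lambda>(a, b) (c, d). (a \<sqinter>\<^bsub>B\<^esub> c, b \<squnion>\<^bsub>B\<^esub> d)),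
     zer = (\<one>\<^bsub>B\<^esub>, \<zero>\<^bsub>B\<^esub>),
     uni = (\<zero>\<^bsub>B\<^esub>, \<one>\<^bsub>B\<^esub>),
     neg = (\<lambda>(a, b). (b, compl B b)),
     dneg = (\<lambda>(a, b). (compl B a, a)),
     ctr = (\<one>\<^bsub>B\<^esub>, \<one>\<^bsub>B\<^esub>)\<rparr>"


section \<open>Algebras of the signature, isomorphism, varieties\<close>

definition is_algebra :: "'a c3dp_sig \<Rightarrow> bool" where
  "is_algebra A \<longleftrightarrow>
     (\<forall>x\<in>carrier A. \<forall>y\<in>carrier A. x \<sqinter>\<^bsub>A\<^esub> y \<in> carrier A \<and> x \<squnion>\<^bsub>A\<^esub> y \<in> carrier A) \<and>
     (\<forall>x\<in>carrier A. \<sim>\<^bsub>A\<^esub> x \<in> carrier A \<and> \<D>\<^bsub>A\<^esub> x \<in> carrier A) \<and>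
     \<zero>\<^bsub>A\<^esub> \<in> carrier A \<and> \<c>\<^bsub>A\<^esub> \<in> carrier A \<and> \<one>\<^bsub>A\<^esub> \<in> carrier A"

definition isomorphic :: "'a c3dp_sig \<Rightarrow> 'b c3dp_sig \<Rightarrow> bool" where
  "isomorphic A B \<longleftrightarrow> is_algebra A \<and> is_algebra B \<and>
     (\<exists>h. bij_betw h (carrier A) (carrier B) \<and>
       (\<forall>x\<in>carrier A. \<forall>y\<in>carrier A.
          h (x \<sqinter>\<^bsub>A\<^esub> y) = h x \<sqinter>\<^bsub>B\<^esub> h y \<and> h (x \<squnion>\<^bsub>A\<^esub> y) = h x \<squnion>\<^bsub>B\<^esub> h y) \<and>
       (\<forall>x\<in>carrier A. h (\<sim>\<^bsub>A\<^esub> x) = \<sim>\<^bsub>B\<^esub> (h x) \<and> h (\<D>\<^bsub>A\<^esub> x) = \<D>\<^bsub>B\<^esub> (h x)) \<and>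
       h \<zero>\<^bsub>A\<^esub> = \<zero>\<^bsub>B\<^esub> \<and> h \<c>\<^bsub>A\<^esub> = \<c>\<^bsub>B\<^esub> \<and> h \<one>\<^bsub>A\<^esub> = \<one>\<^bsub>B\<^esub>)"

text \<open>
  The elements of \<open>contract_algebra B\<close> are pairs, whereas a class of algebras over the universe
  \<open>'a\<close> has type \<open>'a c3dp_sig set\<close>. The class of contract algebras over \<open>'a\<close> therefore consists of
  the isomorphic copies in \<open>'a\<close>; equational classes do not distinguish isomorphic algebras.
  Taking \<open>B\<close> over \<open>'a\<close> loses nothing, since \<open>b \<mapsto> (b, 1)\<close> embeds \<open>B\<close> into its contract algebra.
\<close>

definition contract_algebras :: "'a c3dp_sig set" where
  "contract_algebras = {A. \<exists>B :: 'a boolean_sig. boolean_alg B \<and> isomorphic A (contract_algebra B)}"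

datatype trm = Var nat | Meet trm trm | Join trm trm | Neg trm | DNeg trm | Zero | Ctr | One

primrec trm_val :: "'a c3dp_sig \<Rightarrow> (nat \<Rightarrow> 'a) \<Rightarrow> trm \<Rightarrow> 'a" where
  "trm_val A \<rho> (Var n) = \<rho> n"
| "trm_val A \<rho> (Meet s t) = trm_val A \<rho> s \<sqinter>\<^bsub>A\<^esub> trm_val A \<rho> t"
| "trm_val A \<rho> (Join s t) = trm_val A \<rho> s \<squnion>\<^bsub>A\<^esub> trm_val A \<rho> t"
| "trm_val A \<rho> (Neg t) = \<sim>\<^bsub>A\<^esub> (trm_val A \<rho> t)"
| "trm_val A \<rho> (DNeg t) = \<D>\<^bsub>A\<^esub> (trm_val A \<rho> t)"
| "trm_val A \<rho> Zero = \<zero>\<^bsub>A\<^esub>"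
| "trm_val A \<rho> Ctr = \<c>\<^bsub>A\<^esub>"
| "trm_val A \<rho> One = \<one>\<^bsub>A\<^esub>"

definition satisfies :: "'a c3dp_sig \<Rightarrow> trm \<times> trm \<Rightarrow> bool" where
  "satisfies A e \<longleftrightarrow>
     (\<forall>\<rho>. (\<forall>n. \<rho> n \<in> carrier A) \<longrightarrow> trm_val A \<rho> (fst e) = trm_val A \<rho> (snd e))"

text \<open>
  A variety is an equational class: all algebras (over the universe \<open>'a\<close>) of the signature that
  satisfy some set of identities.
\<close>

definition variety :: "'a c3dp_sig set \<Rightarrow> bool" where
  "variety V \<longleftrightarrow> (\<exists>E. V = {A. is_algebra A \<and> (\<forall>e\<in>E. satisfies A e)})"

definition variety_generated_by :: "'a c3dp_sig set \<Rightarrow> 'a c3dp_sig set \<Rightarrow> bool" where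
  "variety_generated_by V K \<longleftrightarrow>
     variety V \<and> K \<subseteq> V \<and> (\<forall>W. variety W \<and> K \<subseteq> W \<longrightarrow> V \<subseteq> W)"

end

theory Submission
  imports Defs
begin

text \<open>
  Every c3dp-algebra \<open>A\<close> is itself isomorphic to a contract algebra: its complemented elements form
  a Boolean algebra \<open>B\<close>, and \<open>x \<mapsto> (Dx, \<not>\<not>x)\<close> is an isomorphism from \<open>A\<close> onto \<open>C(B)\<close>. It is
  injective because regularity makes an element determined by \<open>\<not>x\<close> and \<open>Dx\<close>, and the centre makes
  it surjective, since \<open>(a, b)\<close> is the image of \<open>(c \<and> b) \<or> \<not>a\<close>. As the axioms of c3dp-algebras are
  equivalent to identities, contract algebras and c3dp-algebras form the same variety.
\<close>

section \<open>Bounded distributive lattices and duality\<close>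

text \<open>The order dual. Exchanging \<open>neg\<close> with \<open>dneg\<close> along with the
  lattice operations lets every fact about \<open>\<sim>\<close> be read off as a fact about
  \<open>\<D>\<close>.\<close>

definition dual :: "('a, 'm) dp_sig_scheme \<Rightarrow> ('a, 'm) dp_sig_scheme" where
  "dual A = A\<lparr>meet := join A, join := meet A, zer := uni A, uni := zer A,
              neg := dneg A, dneg := neg A\<rparr>"

lemma dual_simps [simp]:
  "carrier (dual A) = carrier A"
  "meet (dual A) = join A" "join (dual A) = meet A"
  "zer (dual A) = uni A" "uni (dual A) = zer A"
  "neg (dual A) = dneg A" "dneg (dual A) = neg A"
  by (simp_all add: dual_def)

context bounded_distributive_lattice
begin

lemma meet_idem: "x \<in> carrier A \<Longrightarrow> x \<sqinter> x = x"
  by (metis join_meet_absorb meet_closed meet_join_absorb)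

lemma meet_left_comm:
  "\<lbrakk>x \<in> carrier A; y \<in> carrier A; z \<in> carrier A\<rbrakk> \<Longrightarrow> x \<sqinter> (y \<sqinter> z) = y \<sqinter> (x \<sqinter> z)"
  by (metis meet_assoc meet_comm)

lemma join_left_comm:
  "\<lbrakk>x \<in> carrier A; y \<in> carrier A; z \<in> carrier A\<rbrakk> \<Longrightarrow> x \<squnion> (y \<squnion> z) = y \<squnion> (x \<squnion> z)"
  by (metis join_assoc join_comm)

lemma leq_iff_join: "\<lbrakk>x \<in> carrier A; y \<in> carrier A\<rbrakk> \<Longrightarrow> x \<sqsubseteq> y \<longleftrightarrow> x \<squnion> y = y"
  unfolding leq_def by (metis join_comm join_meet_absorb meet_comm meet_join_absorb)

lemma meet_one: "x \<in> carrier A \<Longrightarrow> x \<sqinter> \<one> = x" "x \<in> carrier A \<Longrightarrow> \<one> \<sqinter> x = x"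
  using one_greatest one_closed meet_comm unfolding leq_def by metis+

lemma meet_zero: "x \<in> carrier A \<Longrightarrow> x \<sqinter> \<zero> = \<zero>" "x \<in> carrier A \<Longrightarrow> \<zero> \<sqinter> x = \<zero>"
  using zero_least zero_closed meet_comm unfolding leq_def by metis+

lemma join_zero: "x \<in> carrier A \<Longrightarrow> x \<squnion> \<zero> = x" "x \<in> carrier A \<Longrightarrow> \<zero> \<squnion> x = x"
  using zero_least zero_closed join_comm leq_iff_join by metis+

lemma join_one: "x \<in> carrier A \<Longrightarrow> x \<squnion> \<one> = \<one>" "x \<in> carrier A \<Longrightarrow> \<one> \<squnion> x = \<one>"
  using one_greatest one_closed join_comm leq_iff_join by metis+

lemma meet_join_distrib2:
  "\<lbrakk>x \<in> carrier A; y \<in> carrier A; z \<in> carrier A\<rbrakk> \<Longrightarrow> (y \<squnion> z) \<sqinter> x = (y \<sqinter> x) \<squnion> (z \<sqinter> x)"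
  by (metis meet_join_distrib meet_comm join_closed)

lemma join_meet_distrib:
  assumes "x \<in> carrier A" "y \<in> carrier A" "z \<in> carrier A"
  shows "x \<squnion> (y \<sqinter> z) = (x \<squnion> y) \<sqinter> (x \<squnion> z)"
proof -
  have "(x \<squnion> y) \<sqinter> (x \<squnion> z) = ((x \<squnion> y) \<sqinter> x) \<squnion> ((x \<squnion> y) \<sqinter> z)"
    using assms by (simp add: meet_join_distrib join_closed)
  also have "\<dots> = x \<squnion> ((x \<sqinter> z) \<squnion> (y \<sqinter> z))"
    using assms by (metis meet_comm meet_join_absorb meet_join_distrib2 join_closed)
  also have "\<dots> = x \<squnion> (y \<sqinter> z)"
    using assms by (metis join_assoc join_meet_absorb meet_closed)
  finally show ?thesis by simp
qed

lemma leq_antisym: "\<lbrakk>x \<in> carrier A; y \<in> carrier A; x \<sqsubseteq> y; y \<sqsubseteq> x\<rbrakk> \<Longrightarrow> x = y"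
  unfolding leq_def by (metis meet_comm)

text \<open>Distributing \<open>y\<close> over the cover \<open>x \<squnion> z = \<one>\<close>
  leaves only the part of \<open>y\<close> below \<open>z\<close>. Used in both directions, this
  gives uniqueness of complements.\<close>

lemma leq_if_disjoint_covering:
  assumes "x \<in> carrier A" "y \<in> carrier A" "z \<in> carrier A"
    and "x \<sqinter> y = \<zero>" "x \<squnion> z = \<one>"
  shows "y \<sqsubseteq> z"
proof -
  have "y = y \<sqinter> (x \<squnion> z)"
    using assms meet_one(1)[of y] by simp
  also have "\<dots> = (x \<sqinter> y) \<squnion> (y \<sqinter> z)"
    using assms by (metis meet_comm meet_join_distrib)
  also have "\<dots> = y \<sqinter> z"
    using assms by (simp add: join_zero meet_closed)
  finally show ?thesis by (simp add: leq_def)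
qed

end

section \<open>Boolean algebras and contract algebras\<close>

context boolean_alg
begin

lemma compl_eqI:
  assumes "x \<in> carrier A" "y \<in> carrier A" "x \<sqinter> y = \<zero>" "x \<squnion> y = \<one>"
  shows "compl A x = y"
  using assms compl_closed leq_if_disjoint_covering join_compl leq_antisym meet_compl by metis

lemma compl_compl: "x \<in> carrier A \<Longrightarrow> compl A (compl A x) = x"
  by (metis compl_closed compl_eqI join_comm join_compl meet_comm meet_compl)

lemma join_compl2: "x \<in> carrier A \<Longrightarrow> compl A x \<squnion> x = \<one>"
  by (metis compl_closed join_comm join_compl)

lemma meet_compl2: "x \<in> carrier A \<Longrightarrow> compl A x \<sqinter> x = \<zero>"
  by (metis compl_closed meet_comm meet_compl)

lemma compl_one: "compl A \<one> = \<zero>"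
  by (auto intro!: compl_eqI simp: zero_closed one_closed meet_one join_zero)

end

text \<open>Most axioms hold coordinatewise, the first coordinate being ordered in reverse. The work
  lies in closure of the carrier and in the extremal properties of \<open>neg\<close> and
  \<open>dneg\<close>.\<close>

lemma c3dp_algebra_contract_algebra:
  fixes B :: "'a boolean_sig"
  assumes "boolean_alg B"
  shows "c3dp_algebra (contract_algebra B)"
proof -
  interpret B: boolean_alg B by fact
  note closed = B.meet_closed B.join_closed B.compl_closed B.zero_closed B.one_closed
  note units = B.meet_one B.join_one B.meet_zero B.join_zero
  note ac = B.meet_comm B.join_comm B.meet_assoc B.join_assoc B.meet_left_comm B.join_left_comm
  \<comment> \<open>This is the carrier condition for the meet of \<open>(a, b)\<close> and
    \<open>(c, d)\<close>; with the coordinates swapped it also serves for the join.\<close>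
  have meet_unit: "(a \<squnion>\<^bsub>B\<^esub> c) \<squnion>\<^bsub>B\<^esub> (b \<sqinter>\<^bsub>B\<^esub> d) = \<one>\<^bsub>B\<^esub>"
    if "a \<in> carrier B" "b \<in> carrier B" "c \<in> carrier B" "d \<in> carrier B"
      "a \<squnion>\<^bsub>B\<^esub> b = \<one>\<^bsub>B\<^esub>" "c \<squnion>\<^bsub>B\<^esub> d = \<one>\<^bsub>B\<^esub>" for a b c d
  proof -
    have "(a \<squnion>\<^bsub>B\<^esub> c) \<squnion>\<^bsub>B\<^esub> b = \<one>\<^bsub>B\<^esub>" "(a \<squnion>\<^bsub>B\<^esub> c) \<squnion>\<^bsub>B\<^esub> d = \<one>\<^bsub>B\<^esub>"
      using that B.join_assoc B.join_comm B.join_one by metis+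
    then show ?thesis
      using that by (simp add: B.join_meet_distrib closed B.meet_idem)
  qed
  show ?thesis
  proof (unfold_locales, goal_cases)
    case (3 x y)
    then show ?case by (auto simp: contract_algebra_def closed meet_unit)
  next
    case (4 x y)
    then show ?case
      by (auto simp: contract_algebra_def closed)
        (metis B.join_comm B.join_closed B.meet_closed meet_unit)
  next
    case (11 x y z)
    then show ?case
      by (auto simp: contract_algebra_def B.join_meet_distrib B.meet_join_distrib)
  next
    case (17 x y)
    obtain a b c d where [simp]: "x = (a, b)" "y = (c, d)" by fastforce
    have carr: "a \<in> carrier B" "b \<in> carrier B" "c \<in> carrier B" "d \<in> carrier B"
      and "c \<squnion>\<^bsub>B\<^esub> d = \<one>\<^bsub>B\<^esub>" "b \<sqinter>\<^bsub>B\<^esub> d = \<zero>\<^bsub>B\<^esub>"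
      using 17 by (auto simp: contract_algebra_def)
    \<comment> \<open>Because of the reversed first coordinate, \<open>y\<close> lies below
      \<open>(b, compl B b)\<close> exactly when \<open>b\<close> is below \<open>c\<close> and
      \<open>d\<close> is below \<open>compl B b\<close>. The former rests on the carrier condition
      for \<open>y\<close>.\<close>
    then have "b \<sqsubseteq>\<^bsub>B\<^esub> c" "d \<sqsubseteq>\<^bsub>B\<^esub> compl B b"
      using B.leq_if_disjoint_covering[of d b c] B.leq_if_disjoint_covering[of b d "compl B b"]
      by (simp_all add: B.join_compl B.compl_closed B.meet_comm B.join_comm)
    then show ?case
      using carr B.leq_iff_join[of b c]
      by (simp add: contract_algebra_def leq_def B.join_comm)
  next
    case (19 x y)
    obtain a b c d where [simp]: "x = (a, b)" "y = (c, d)" by fastforce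
    have carr: "a \<in> carrier B" "b \<in> carrier B" "c \<in> carrier B" "d \<in> carrier B"
      and "c \<squnion>\<^bsub>B\<^esub> d = \<one>\<^bsub>B\<^esub>" "a \<sqinter>\<^bsub>B\<^esub> c = \<zero>\<^bsub>B\<^esub>"
      using 19 by (auto simp: contract_algebra_def)
    \<comment> \<open>Dually, \<open>(compl B a, a)\<close> lies below \<open>y\<close> exactly when
      \<open>c\<close> is below \<open>compl B a\<close> and \<open>a\<close> is below
      \<open>d\<close>.\<close>
    then have "a \<sqsubseteq>\<^bsub>B\<^esub> d" "c \<sqsubseteq>\<^bsub>B\<^esub> compl B a"
      using B.leq_if_disjoint_covering[of c a d] B.leq_if_disjoint_covering[of a c "compl B a"]
      by (simp_all add: B.join_compl B.compl_closed B.meet_comm B.join_comm)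
    then show ?case
      using carr B.leq_iff_join[of c "compl B a"]
      by (simp add: contract_algebra_def leq_def B.join_comm B.compl_closed)
  qed (auto simp: contract_algebra_def leq_def closed units ac B.join_meet_absorb
      B.meet_join_absorb B.meet_compl B.meet_compl2
      B.join_compl B.join_compl2 B.compl_compl B.compl_one)
qed

section \<open>Pseudocomplements\<close>

context dp_algebra
begin

lemma leq_neg_iff:
  assumes "x \<in> carrier A" "y \<in> carrier A"
  shows "y \<sqsubseteq> \<sim> x \<longleftrightarrow> x \<sqinter> y = \<zero>"
proof
  assume "y \<sqsubseteq> \<sim> x"
  then have "x \<sqinter> y = x \<sqinter> (\<sim> x \<sqinter> y)"
    unfolding leq_def using assms by (metis meet_comm neg_closed)
  also have "\<dots> = \<zero>"
    using assms by (metis meet_assoc meet_neg meet_zero(2) neg_closed)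
  finally show "x \<sqinter> y = \<zero>" .
qed (use assms neg_greatest in blast)

text \<open>The axioms are self-dual up to the second distributive law and the passage between the
  meet and join forms of the order.\<close>

lemma dp_algebra_dual: "dp_algebra (dual A)"
proof (unfold_locales, goal_cases)
  case (11 x y z)
  then show ?case by (simp add: join_meet_distrib)
next
  case (17 x y)
  then show ?case
    using dneg_least leq_iff_join[of "\<D> x" y] by (simp add: leq_def dneg_closed join_comm)
next
  case (19 x y)
  then show ?case
    using neg_greatest[of x y] leq_iff_join[of y "\<sim> x"]
    by (simp add: leq_def neg_closed join_comm)
qed (auto simp: leq_def zero_closed one_closed meet_closed join_closed meet_comm join_comm
  meet_assoc join_assoc meet_left_comm join_left_comm meet_join_absorb join_meet_absorb join_one
  join_zero neg_closed dneg_closed meet_neg join_dneg)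

lemma neg_zero: "\<sim> \<zero> = \<one>"
  using leq_neg_iff[of \<zero> \<one>] by (metis leq_def meet_one(2) meet_zero(2) neg_closed one_closed zero_closed)

lemma neg_one: "\<sim> \<one> = \<zero>"
  by (metis meet_neg meet_one(2) neg_closed one_closed)

text \<open>Both inequalities reduce through \<open>leq_neg_iff\<close> to disjointness, which
  distributivity checks separately on \<open>x\<close> and on \<open>y\<close>.\<close>

lemma neg_join:
  assumes x: "x \<in> carrier A" and y: "y \<in> carrier A"
  shows "\<sim> (x \<squnion> y) = \<sim> x \<sqinter> \<sim> y"
proof (rule leq_antisym)
  let ?n = "\<sim> (x \<squnion> y)"
  have n: "?n \<in> carrier A" using x y by (simp add: join_closed neg_closed)
  have zero: "(x \<sqinter> ?n) \<squnion> (y \<sqinter> ?n) = \<zero>"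
    using meet_neg[of "x \<squnion> y"] x y n by (simp add: join_closed meet_join_distrib2)
  then have "x \<sqinter> ?n = \<zero>" "y \<sqinter> ?n = \<zero>"
    using x y n by (metis join_comm meet_closed meet_join_absorb meet_zero(1))+
  then have "?n \<sqsubseteq> \<sim> x" "?n \<sqsubseteq> \<sim> y"
    using x y n by (simp_all add: leq_neg_iff)
  then show "?n \<sqsubseteq> \<sim> x \<sqinter> \<sim> y"
    unfolding leq_def using x y n by (metis meet_assoc neg_closed)
  have "x \<sqinter> (\<sim> x \<sqinter> \<sim> y) = \<zero>" "y \<sqinter> (\<sim> x \<sqinter> \<sim> y) = \<zero>"
    using x y by (metis meet_assoc meet_neg meet_zero(2) neg_closed,
        metis meet_left_comm meet_neg meet_zero(1) neg_closed)
  then show "\<sim> x \<sqinter> \<sim> y \<sqsubseteq> ?n"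
    using x y by (simp add: leq_neg_iff join_closed meet_closed neg_closed meet_join_distrib2
        join_zero zero_closed)
qed (use x y in \<open>simp_all add: join_closed meet_closed neg_closed\<close>)

text \<open>This identity later replaces the quasi-identity \<open>neg_greatest\<close>. Below
  \<open>x\<close>, being disjoint from \<open>x \<sqinter> y\<close> is the same as being disjoint
  from \<open>y\<close>.\<close>

lemma meet_neg_meet:
  assumes x: "x \<in> carrier A" and y: "y \<in> carrier A"
  shows "x \<sqinter> \<sim> (x \<sqinter> y) = x \<sqinter> \<sim> y"
proof (rule leq_antisym)
  let ?n = "\<sim> (x \<sqinter> y)"
  have n: "?n \<in> carrier A" using x y by (simp add: meet_closed neg_closed)
  have "y \<sqinter> (x \<sqinter> ?n) = \<zero>"
    using meet_neg[of "x \<sqinter> y"] x y n by (metis meet_assoc meet_closed meet_comm)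
  then have "x \<sqinter> ?n \<sqsubseteq> \<sim> y"
    using x y n by (simp add: leq_neg_iff meet_closed)
  then show "x \<sqinter> ?n \<sqsubseteq> x \<sqinter> \<sim> y"
    unfolding leq_def using x y n
    by (metis meet_assoc meet_closed meet_comm meet_idem neg_closed)
  have "(x \<sqinter> y) \<sqinter> \<sim> y = \<zero>"
    using x y by (metis meet_assoc meet_neg meet_zero(1) neg_closed)
  then have "\<sim> y \<sqsubseteq> ?n"
    using x y by (simp add: leq_neg_iff meet_closed neg_closed)
  then show "x \<sqinter> \<sim> y \<sqsubseteq> x \<sqinter> ?n"
    unfolding leq_def using x y n
    by (metis meet_assoc meet_closed meet_comm meet_idem neg_closed)
qed (use x y in \<open>simp_all add: join_closed meet_closed neg_closed\<close>)

lemma complement_eq: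
  assumes "x \<in> carrier A" "y \<in> carrier A" "x \<sqinter> y = \<zero>" "x \<squnion> y = \<one>"
  shows "\<sim> x = y" and "\<D> x = y"
  using assms by (metis leq_if_disjoint_covering leq_antisym meet_neg neg_greatest neg_closed,
      metis leq_if_disjoint_covering leq_antisym join_dneg dneg_least dneg_closed)

end

section \<open>Consequences of the Stone identities and of regularity\<close>

context three_valued_dp_algebra
begin

text \<open>Dualising exchanges the two Stone identities and turns regularity into itself with
  \<open>x\<close> and \<open>y\<close> interchanged.\<close>

lemma three_valued_dp_algebra_dual: "three_valued_dp_algebra (dual A)"
proof -
  interpret dual: dp_algebra "dual A" by (rule dp_algebra_dual)
  show ?thesis
  proof (unfold_locales, goal_cases)
    case (1 x y)
    then show ?case
      using regular[of y x] leq_iff_join[of "y \<sqinter> \<D> y" "x \<squnion> \<sim> x"]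
      by (simp add: leq_def meet_closed join_closed neg_closed dneg_closed join_comm)
  qed (simp_all add: stone dual_stone)
qed

lemma neg_neg_neg:
  assumes "x \<in> carrier A"
  shows "\<sim> (\<sim> (\<sim> x)) = \<sim> x"
  using assms by (metis complement_eq(1) join_comm meet_comm meet_neg neg_closed stone)

text \<open>For the harder inequality, the Stone identity splits \<open>?n\<close> into a part below
  \<open>\<sim> y\<close> and a part below \<open>\<sim> (\<sim> y)\<close>; the latter is disjoint
  from \<open>x\<close>, hence below \<open>\<sim> x\<close>.\<close>

lemma neg_meet:
  assumes x: "x \<in> carrier A" and y: "y \<in> carrier A"
  shows "\<sim> (x \<sqinter> y) = \<sim> x \<squnion> \<sim> y"
proof (rule leq_antisym)
  let ?n = "\<sim> (x \<sqinter> y)"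
  have n: "?n \<in> carrier A" using x y by (simp add: meet_closed neg_closed)
  have nny: "\<sim> (\<sim> y) \<in> carrier A" using y by (simp add: neg_closed)
  have "y \<sqinter> (x \<sqinter> ?n) = \<zero>"
    using meet_neg[of "x \<sqinter> y"] x y n by (metis meet_assoc meet_closed meet_comm)
  \<comment> \<open>Rewriting \<open>\<sim> y\<close> as a triple negation strengthens disjointness
    from \<open>y\<close> to disjointness from \<open>\<sim> (\<sim> y)\<close>.\<close>
  then have "x \<sqinter> ?n \<sqsubseteq> \<sim> (\<sim> (\<sim> y))"
    using x y n by (simp add: leq_neg_iff meet_closed neg_neg_neg)
  then have "x \<sqinter> (\<sim> (\<sim> y) \<sqinter> ?n) = \<zero>"
    using x y n nny by (simp add: leq_neg_iff meet_closed meet_left_comm)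
  then have "\<sim> (\<sim> y) \<sqinter> ?n \<sqsubseteq> \<sim> x"
    using x n nny by (simp add: leq_neg_iff meet_closed)
  then have le: "(\<sim> (\<sim> y) \<sqinter> ?n) \<squnion> \<sim> x = \<sim> x"
    using x n nny by (simp add: leq_iff_join meet_closed neg_closed)
  have "?n = (\<sim> y \<squnion> \<sim> (\<sim> y)) \<sqinter> ?n"
    using y n by (simp add: stone meet_one)
  also have "\<dots> = (\<sim> y \<sqinter> ?n) \<squnion> (\<sim> (\<sim> y) \<sqinter> ?n)"
    using y n by (simp add: meet_join_distrib2 neg_closed)
  finally have split: "?n = (\<sim> y \<sqinter> ?n) \<squnion> (\<sim> (\<sim> y) \<sqinter> ?n)" .
  have "?n \<squnion> (\<sim> x \<squnion> \<sim> y)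
      = ((\<sim> y \<sqinter> ?n) \<squnion> \<sim> y) \<squnion> ((\<sim> (\<sim> y) \<sqinter> ?n) \<squnion> \<sim> x)"
    by (subst split) (use x y n in \<open>simp add: join_assoc join_comm join_left_comm
        meet_closed join_closed neg_closed\<close>)
  also have "\<dots> = \<sim> x \<squnion> \<sim> y"
    using x y n le by (metis join_comm join_meet_absorb meet_closed neg_closed)
  finally show "?n \<sqsubseteq> \<sim> x \<squnion> \<sim> y"
    using x y n by (simp add: leq_iff_join join_closed neg_closed)
  have "(x \<sqinter> y) \<sqinter> \<sim> x = \<zero>" "(x \<sqinter> y) \<sqinter> \<sim> y = \<zero>"
    using x y by (metis meet_assoc meet_comm meet_neg meet_zero(1) neg_closed)+
  then show "\<sim> x \<squnion> \<sim> y \<sqsubseteq> ?n"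
    using x y by (simp add: leq_neg_iff join_closed meet_closed neg_closed meet_join_distrib
        join_zero zero_closed)
qed (use x y in \<open>simp_all add: join_closed meet_closed neg_closed\<close>)

text \<open>Cover \<open>x\<close> by \<open>y \<squnion> \<D> y\<close>, where
  \<open>\<D> y = \<D> x\<close>. By regularity \<open>x \<sqinter> \<D> x\<close> is below
  \<open>y \<squnion> \<sim> y\<close>, and meeting with \<open>x\<close> removes
  \<open>\<sim> y = \<sim> x\<close>; so both parts of \<open>x\<close> lie below
  \<open>y\<close>.\<close>

lemma determination:
  assumes x: "x \<in> carrier A" and y: "y \<in> carrier A"
    and n: "\<sim> x = \<sim> y" and d: "\<D> x = \<D> y"
  shows "x = y"
proof -
  have le: "x \<sqsubseteq> y" if x: "x \<in> carrier A" and y: "y \<in> carrier A"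
    and n: "\<sim> x = \<sim> y" and d: "\<D> x = \<D> y" for x y
  proof -
    have "x \<sqinter> \<D> x = x \<sqinter> ((x \<sqinter> \<D> x) \<sqinter> (y \<squnion> \<sim> y))"
      using regular[OF x y] x y unfolding leq_def
      by (metis meet_assoc meet_idem dneg_closed)
    also have "\<dots> = (x \<sqinter> \<D> x) \<sqinter> (x \<sqinter> (y \<squnion> \<sim> y))"
      using x y by (simp add: meet_left_comm meet_closed dneg_closed join_closed neg_closed)
    also have "x \<sqinter> (y \<squnion> \<sim> y) = x \<sqinter> y"
      using x y by (simp add: meet_join_distrib neg_closed flip: n)
        (simp add: meet_neg join_zero meet_closed)
    finally have "(x \<sqinter> \<D> x) \<sqsubseteq> x \<sqinter> y"
      unfolding leq_def by simp
    then have "(x \<sqinter> y) \<squnion> (x \<sqinter> \<D> x) = x \<sqinter> y"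
      using x y by (simp add: leq_iff_join meet_closed dneg_closed join_comm)
    moreover have "x = x \<sqinter> (y \<squnion> \<D> y)"
      using x y by (simp add: join_dneg meet_one)
    ultimately show ?thesis
      using x y by (simp add: leq_def meet_join_distrib dneg_closed d)
  qed
  show ?thesis
    using le[of x y] le[of y x] assms by (auto intro: leq_antisym)
qed

end

section \<open>Representation by contract algebras\<close>

text \<open>Since \<open>x \<sqinter> \<sim> x\<close> is always zero, the carrier condition singles
  out the complemented elements. The elements keep their type, as \<open>contract_algebras\<close>
  requires.\<close>

definition skeleton :: "'a c3dp_sig \<Rightarrow> 'a boolean_sig" where
  "skeleton A = \<lparr>carrier = {x \<in> carrier A. x \<squnion>\<^bsub>A\<^esub> \<sim>\<^bsub>A\<^esub> x = \<one>\<^bsub>A\<^esub>},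
     meet = meet A, join = join A, zer = zer A, uni = uni A, compl = neg A\<rparr>"

lemma c3dp_algebra_is_algebra: "c3dp_algebra A \<Longrightarrow> is_algebra A"
proof -
  assume "c3dp_algebra A"
  then interpret c3dp_algebra A .
  show ?thesis
    by (simp add: is_algebra_def meet_closed join_closed neg_closed dneg_closed
        zero_closed one_closed ctr_closed)
qed

text \<open>The two De Morgan laws give closure under meet and join; the Stone identity gives
  closure under complement.\<close>

lemma boolean_alg_skeleton:
  assumes "c3dp_algebra A"
  shows "boolean_alg (skeleton A)"
proof -
  interpret c3dp_algebra A by fact
  have join_unit: "(x \<squnion>\<^bsub>A\<^esub> y) \<squnion>\<^bsub>A\<^esub> (u \<sqinter>\<^bsub>A\<^esub> v) = \<one>\<^bsub>A\<^esub>"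
    if "x \<in> carrier A" "y \<in> carrier A" "u \<in> carrier A" "v \<in> carrier A"
      "x \<squnion>\<^bsub>A\<^esub> u = \<one>\<^bsub>A\<^esub>" "y \<squnion>\<^bsub>A\<^esub> v = \<one>\<^bsub>A\<^esub>" for x y u v
  proof -
    have "(x \<squnion>\<^bsub>A\<^esub> y) \<squnion>\<^bsub>A\<^esub> u = \<one>\<^bsub>A\<^esub>" "(x \<squnion>\<^bsub>A\<^esub> y) \<squnion>\<^bsub>A\<^esub> v = \<one>\<^bsub>A\<^esub>"
      using that join_assoc join_comm join_one by metis+
    then show ?thesis
      using that by (simp add: join_meet_distrib join_closed meet_idem one_closed)
  qed
  show ?thesis
  proof (unfold_locales, goal_cases)
    case (3 x y)
    then show ?case
      using join_unit[of "\<sim>\<^bsub>A\<^esub> x" "\<sim>\<^bsub>A\<^esub> y" x y]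
      by (simp add: skeleton_def meet_closed join_closed neg_meet neg_closed join_comm)
  next
    case (4 x y)
    then show ?case
      by (simp add: skeleton_def join_closed neg_join neg_closed join_unit)
  qed (auto simp: skeleton_def leq_def zero_closed one_closed meet_closed join_closed meet_comm
      join_comm meet_assoc join_assoc meet_left_comm join_left_comm meet_join_absorb
      join_meet_absorb meet_join_distrib meet_one meet_zero join_one join_zero neg_closed meet_neg
      neg_zero neg_one stone)
qed

text \<open>De Morgan for \<open>\<sim>\<close> and \<open>\<D>\<close> makes the map respect meet
  and join. It respects \<open>neg\<close> and \<open>dneg\<close> because \<open>\<sim> x\<close>
  and \<open>\<D> x\<close> are complemented, and on complemented elements the two operations agree
  and are involutive.\<close>

lemma isomorphic_contract_algebra_skeleton:
  assumes "c3dp_algebra A"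
  shows "isomorphic A (contract_algebra (skeleton A))"
proof -
  interpret c3dp_algebra A by fact
  interpret dual: three_valued_dp_algebra "dual A"
    by (rule three_valued_dp_algebra_dual)
  let ?C = "contract_algebra (skeleton A)"
  let ?h = "\<lambda>x. (\<D>\<^bsub>A\<^esub> x, \<sim>\<^bsub>A\<^esub> (\<sim>\<^bsub>A\<^esub> x))"
  have dneg_join: "\<D>\<^bsub>A\<^esub> (x \<squnion>\<^bsub>A\<^esub> y) = \<D>\<^bsub>A\<^esub> x \<sqinter>\<^bsub>A\<^esub> \<D>\<^bsub>A\<^esub> y"
    and dneg_meet: "\<D>\<^bsub>A\<^esub> (x \<sqinter>\<^bsub>A\<^esub> y) = \<D>\<^bsub>A\<^esub> x \<squnion>\<^bsub>A\<^esub> \<D>\<^bsub>A\<^esub> y"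
    if "x \<in> carrier A" "y \<in> carrier A" for x y
    using dual.neg_meet[of x y] dual.neg_join[of x y] that by simp_all
  have compl_neg: "\<D>\<^bsub>A\<^esub> x = \<sim>\<^bsub>A\<^esub> x" "\<sim>\<^bsub>A\<^esub> (\<sim>\<^bsub>A\<^esub> x) = x"
    if "x \<in> carrier A" "x \<squnion>\<^bsub>A\<^esub> \<sim>\<^bsub>A\<^esub> x = \<one>\<^bsub>A\<^esub>" for x
    using complement_eq[of x "\<sim>\<^bsub>A\<^esub> x"] complement_eq[of "\<sim>\<^bsub>A\<^esub> x" x] that
    by (simp_all add: neg_closed meet_neg meet_comm join_comm)
  have neg_dneg: "\<sim>\<^bsub>A\<^esub> (\<D>\<^bsub>A\<^esub> x) = \<D>\<^bsub>A\<^esub> (\<D>\<^bsub>A\<^esub> x)" if "x \<in> carrier A" for x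
    using complement_eq[of "\<D>\<^bsub>A\<^esub> x" "\<D>\<^bsub>A\<^esub> (\<D>\<^bsub>A\<^esub> x)"] that
    by (simp add: dneg_closed dual_stone join_dneg)
  have join_neg_dneg: "\<D>\<^bsub>A\<^esub> x \<squnion>\<^bsub>A\<^esub> \<sim>\<^bsub>A\<^esub> (\<D>\<^bsub>A\<^esub> x) = \<one>\<^bsub>A\<^esub>" if "x \<in> carrier A" for x
    using that by (simp add: neg_dneg dneg_closed join_dneg)
  have join_h: "\<D>\<^bsub>A\<^esub> x \<squnion>\<^bsub>A\<^esub> \<sim>\<^bsub>A\<^esub> (\<sim>\<^bsub>A\<^esub> x) = \<one>\<^bsub>A\<^esub>" if x: "x \<in> carrier A" for x
  proof -
    \<comment> \<open>The image satisfies the carrier condition because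
      \<open>\<sim> (\<sim> x)\<close> lies above \<open>x\<close>, which together with
      \<open>\<D> x\<close> already joins to one.\<close>
    have "x \<sqsubseteq>\<^bsub>A\<^esub> \<sim>\<^bsub>A\<^esub> (\<sim>\<^bsub>A\<^esub> x)"
      using x by (metis leq_neg_iff meet_comm meet_neg neg_closed)
    then have "\<sim>\<^bsub>A\<^esub> (\<sim>\<^bsub>A\<^esub> x) = x \<squnion>\<^bsub>A\<^esub> \<sim>\<^bsub>A\<^esub> (\<sim>\<^bsub>A\<^esub> x)"
      using x by (simp add: leq_iff_join neg_closed)
    then have "\<D>\<^bsub>A\<^esub> x \<squnion>\<^bsub>A\<^esub> \<sim>\<^bsub>A\<^esub> (\<sim>\<^bsub>A\<^esub> x) = (x \<squnion>\<^bsub>A\<^esub> \<D>\<^bsub>A\<^esub> x) \<squnion>\<^bsub>A\<^esub> \<sim>\<^bsub>A\<^esub> (\<sim>\<^bsub>A\<^esub> x)"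
      using x by (metis dneg_closed join_assoc join_comm neg_closed)
    then show ?thesis
      using x by (simp add: join_dneg join_one neg_closed)
  qed
  have h_closed: "?h x \<in> carrier ?C" if "x \<in> carrier A" for x
    using that by (simp add: contract_algebra_def skeleton_def neg_closed dneg_closed
        join_neg_dneg join_h neg_neg_neg stone join_comm)
  have "inj_on ?h (carrier A)"
  proof (rule inj_onI)
    fix x y assume xy: "x \<in> carrier A" "y \<in> carrier A" "?h x = ?h y"
    \<comment> \<open>A third negation recovers \<open>\<sim> x\<close> from the second
      coordinate.\<close>
    then have "\<sim>\<^bsub>A\<^esub> x = \<sim>\<^bsub>A\<^esub> y" by (metis neg_neg_neg prod.inject)
    then show "x = y" using xy by (auto intro: determination)
  qed
  moreover have "?h ` carrier A = carrier ?C"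
  proof (intro equalityI subsetI)
    fix p assume "p \<in> carrier ?C"
    then obtain a b where p: "p = (a, b)" and a: "a \<in> carrier A" "a \<squnion>\<^bsub>A\<^esub> \<sim>\<^bsub>A\<^esub> a = \<one>\<^bsub>A\<^esub>"
      and b: "b \<in> carrier A" "b \<squnion>\<^bsub>A\<^esub> \<sim>\<^bsub>A\<^esub> b = \<one>\<^bsub>A\<^esub>" and ab: "a \<squnion>\<^bsub>A\<^esub> b = \<one>\<^bsub>A\<^esub>"
      by (auto simp: contract_algebra_def skeleton_def)
    \<comment> \<open>As \<open>\<D> \<c> = \<one>\<close> and \<open>\<sim> \<c> = \<zero>\<close>,
      the element \<open>\<c> \<sqinter> b\<close> goes to \<open>(\<one>, b)\<close>, while
      \<open>\<sim> a\<close> goes to \<open>(a, \<sim> a)\<close>. Their join goes to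
      \<open>(a, b)\<close>, because \<open>ab\<close> forces \<open>\<sim> a\<close> below
      \<open>b\<close>.\<close>
    let ?x = "(\<c>\<^bsub>A\<^esub> \<sqinter>\<^bsub>A\<^esub> b) \<squnion>\<^bsub>A\<^esub> \<sim>\<^bsub>A\<^esub> a"
    have "\<sim>\<^bsub>A\<^esub> a \<sqsubseteq>\<^bsub>A\<^esub> b"
      using leq_if_disjoint_covering[of a "\<sim>\<^bsub>A\<^esub> a" b] a b ab by (simp add: neg_closed meet_neg)
    then have "b \<squnion>\<^bsub>A\<^esub> \<sim>\<^bsub>A\<^esub> a = b"
      using a b by (simp add: leq_iff_join neg_closed join_comm)
    moreover have "\<D>\<^bsub>A\<^esub> (\<sim>\<^bsub>A\<^esub> a) = a"
      using compl_neg(1)[of "\<sim>\<^bsub>A\<^esub> a"] compl_neg(2)[of a] a by (simp add: neg_closed join_comm)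
    ultimately have "?h ?x = p"
      using a b by (simp add: p dneg_join dneg_meet neg_join neg_meet meet_closed join_closed
          neg_closed dneg_closed ctr_closed dneg_ctr neg_ctr neg_zero join_one meet_one
          join_zero compl_neg)
    moreover have "?x \<in> carrier A"
      using a b by (simp add: ctr_closed meet_closed join_closed neg_closed)
    ultimately show "p \<in> ?h ` carrier A" by force
  qed (use h_closed in auto)
  ultimately have "bij_betw ?h (carrier A) (carrier ?C)"
    by (simp add: bij_betw_def)
  moreover have "?h (x \<sqinter>\<^bsub>A\<^esub> y) = ?h x \<sqinter>\<^bsub>?C\<^esub> ?h y \<and> ?h (x \<squnion>\<^bsub>A\<^esub> y) = ?h x \<squnion>\<^bsub>?C\<^esub> ?h y"
    if "x \<in> carrier A" "y \<in> carrier A" for x y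
    using that by (simp add: contract_algebra_def skeleton_def dneg_join dneg_meet neg_join
        neg_meet neg_closed)
  moreover have "?h (\<sim>\<^bsub>A\<^esub> x) = \<sim>\<^bsub>?C\<^esub> (?h x) \<and> ?h (\<D>\<^bsub>A\<^esub> x) = \<D>\<^bsub>?C\<^esub> (?h x)"
    if "x \<in> carrier A" for x
    using that compl_neg(1)[of "\<sim>\<^bsub>A\<^esub> x"] compl_neg(2)[of "\<D>\<^bsub>A\<^esub> x"]
    by (simp add: contract_algebra_def skeleton_def neg_closed dneg_closed stone neg_dneg
        join_neg_dneg join_dneg)
  moreover have "?h \<zero>\<^bsub>A\<^esub> = \<zero>\<^bsub>?C\<^esub>" "?h \<c>\<^bsub>A\<^esub> = \<c>\<^bsub>?C\<^esub>" "?h \<one>\<^bsub>A\<^esub> = \<one>\<^bsub>?C\<^esub>"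
    using dual.neg_zero dual.neg_one
    by (simp_all add: contract_algebra_def skeleton_def neg_zero neg_one neg_ctr dneg_ctr)
  moreover have "is_algebra ?C"
    using boolean_alg_skeleton[OF assms] c3dp_algebra_contract_algebra
    by (blast intro: c3dp_algebra_is_algebra)
  ultimately show ?thesis
    unfolding isomorphic_def using c3dp_algebra_is_algebra[OF assms] by blast
qed

section \<open>The equational axioms\<close>

text \<open>
  The quasi-identities defining \<open>\<not>\<close> are replaced by \<open>x \<and> \<not>(x \<and> y) = x \<and> \<not>y\<close> and \<open>\<not>0 = 1\<close>, and
  dually for \<open>D\<close>.
\<close>

definition c3dp_identities :: "(trm \<times> trm) set" where
  "c3dp_identities = (let x = Var 0; y = Var 1; z = Var 2 in {
     (Meet x y, Meet y x),
     (Join x y, Join y x),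
     (Meet (Meet x y) z, Meet x (Meet y z)),
     (Join (Join x y) z, Join x (Join y z)),
     (Meet x (Join x y), x),
     (Join x (Meet x y), x),
     (Meet x (Join y z), Join (Meet x y) (Meet x z)),
     (Meet Zero x, Zero),
     (Meet x One, x),
     (Meet x (Neg x), Zero),
     (Meet x (Neg (Meet x y)), Meet x (Neg y)),
     (Neg Zero, One),
     (Join x (DNeg x), One),
     (Join x (DNeg (Join x y)), Join x (DNeg y)),
     (DNeg One, Zero),
     (Meet (Meet x (DNeg x)) (Join y (Neg y)), Meet x (DNeg x)),
     (Join (Neg x) (Neg (Neg x)), One),
     (Meet (DNeg x) (DNeg (DNeg x)), Zero),
     (Neg Ctr, Zero),
     (DNeg Ctr, One)})"

text \<open>The substitutes for \<open>neg_greatest\<close> and \<open>dneg_least\<close> are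
  \<open>meet_neg_meet\<close> and \<open>neg_zero\<close> with their order duals; the other
  identities are axioms.\<close>

lemma satisfies_c3dp_identities:
  assumes "c3dp_algebra A" "e \<in> c3dp_identities"
  shows "satisfies A e"
proof -
  interpret c3dp_algebra A by fact
  interpret dual: three_valued_dp_algebra "dual A"
    by (rule three_valued_dp_algebra_dual)
  have "x \<squnion>\<^bsub>A\<^esub> \<D>\<^bsub>A\<^esub> (x \<squnion>\<^bsub>A\<^esub> y) = x \<squnion>\<^bsub>A\<^esub> \<D>\<^bsub>A\<^esub> y" if "x \<in> carrier A" "y \<in> carrier A" for x y
    using dual.meet_neg_meet[of x y] that by simp
  moreover have "\<D>\<^bsub>A\<^esub> \<one>\<^bsub>A\<^esub> = \<zero>\<^bsub>A\<^esub>"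
    using dual.neg_zero by simp
  ultimately show ?thesis
    using assms(2) unfolding c3dp_identities_def Let_def satisfies_def
    by (elim insertE emptyE;
        (simp add: meet_assoc join_assoc meet_join_absorb join_meet_absorb meet_zero meet_one
          meet_neg meet_neg_meet neg_zero join_dneg stone dual_stone neg_ctr dneg_ctr
          neg_closed dneg_closed; fail)?;
        simp add: meet_join_distrib meet_comm join_comm regular[unfolded leq_def])
qed

text \<open>\<open>c3dp_identities\<close> mentions only three variables; all later ones take the
  value \<open>z\<close> so that the valuation stays in the carrier.\<close>

lemma satisfiesD:
  assumes "satisfies A e" "x \<in> carrier A" "y \<in> carrier A" "z \<in> carrier A"
  defines "\<rho> \<equiv> \<lambda>n::nat. if n = 0 then x else if n = 1 then y else z"
  shows "trm_val A \<rho> (fst e) = trm_val A \<rho> (snd e)"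
  using assms by (simp add: satisfies_def)

lemma c3dp_algebra_iff_identities:
  "c3dp_algebra A \<longleftrightarrow> is_algebra A \<and> (\<forall>e\<in>c3dp_identities. satisfies A e)"
proof
  assume "is_algebra A \<and> (\<forall>e\<in>c3dp_identities. satisfies A e)"
  then have alg: "is_algebra A" and sat: "\<And>e. e \<in> c3dp_identities \<Longrightarrow> satisfies A e"
    by auto
  note closed = alg[unfolded is_algebra_def]
  have id: "\<forall>e\<in>c3dp_identities. trm_val A (\<lambda>n. if n = 0 then x else if n = 1 then y else z) (fst e)
      = trm_val A (\<lambda>n. if n = 0 then x else if n = 1 then y else z) (snd e)"
    if "x \<in> carrier A" "y \<in> carrier A" "z \<in> carrier A" for x y z
    using satisfiesD[OF sat] that by blast
  note id = id[unfolded c3dp_identities_def Let_def, simplified]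
  \<comment> \<open>Zero fills the places of variables that an identity does not mention.\<close>
  have c: "\<zero>\<^bsub>A\<^esub> \<in> carrier A" using closed by blast
  have comm: "x \<sqinter>\<^bsub>A\<^esub> y = y \<sqinter>\<^bsub>A\<^esub> x" "x \<squnion>\<^bsub>A\<^esub> y = y \<squnion>\<^bsub>A\<^esub> x"
    if "x \<in> carrier A" "y \<in> carrier A" for x y
    using id[OF that c] by blast+
  interpret bounded_distributive_lattice A
    by (unfold_locales; (use closed in blast)?; (use id c comm in \<open>(simp add: leq_def; fail)\<close>)?)
  show "c3dp_algebra A"
  proof (unfold_locales, goal_cases)
    case (4 x y)
    \<comment> \<open>Maximality of \<open>\<sim> x\<close> is recovered equationally: once
      \<open>y \<sqinter> x\<close> is zero, the right side becomes
      \<open>y \<sqinter> \<sim> \<zero>\<close>, which is \<open>y\<close>.\<close>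
    have "y \<sqinter>\<^bsub>A\<^esub> \<sim>\<^bsub>A\<^esub> x = y \<sqinter>\<^bsub>A\<^esub> \<sim>\<^bsub>A\<^esub> (y \<sqinter>\<^bsub>A\<^esub> x)"
      using 4(1,2) id[of y x "\<zero>\<^bsub>A\<^esub>"] c by metis
    also have "y \<sqinter>\<^bsub>A\<^esub> x = \<zero>\<^bsub>A\<^esub>"
      using 4 comm(1)[of y x] by simp
    also have "y \<sqinter>\<^bsub>A\<^esub> \<sim>\<^bsub>A\<^esub> \<zero>\<^bsub>A\<^esub> = y"
      using 4 id[of y x "\<zero>\<^bsub>A\<^esub>"] c by simp
    finally show ?case
      by (simp add: leq_def)
  next
    case (6 x y)
    \<comment> \<open>The dual computation ends in \<open>y \<squnion> \<D> \<one> = y\<close>, the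
      join form of the required inequality.\<close>
    have "y \<squnion>\<^bsub>A\<^esub> \<D>\<^bsub>A\<^esub> x = y \<squnion>\<^bsub>A\<^esub> \<D>\<^bsub>A\<^esub> (y \<squnion>\<^bsub>A\<^esub> x)"
      using 6(1,2) id[of y x "\<zero>\<^bsub>A\<^esub>"] c by metis
    also have "y \<squnion>\<^bsub>A\<^esub> x = \<one>\<^bsub>A\<^esub>"
      using 6 comm(2)[of y x] by simp
    also have "y \<squnion>\<^bsub>A\<^esub> \<D>\<^bsub>A\<^esub> \<one>\<^bsub>A\<^esub> = y"
      using 6 id[of y x "\<zero>\<^bsub>A\<^esub>"] c by (simp add: join_zero)
    finally show ?case
      using 6 closed comm[of y "\<D>\<^bsub>A\<^esub> x"] by (simp add: leq_iff_join)
  next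
    case (7 x y)
    then show ?case
      using id[of x y "\<zero>\<^bsub>A\<^esub>"] c by (simp add: leq_def)
  qed (use id c closed in \<open>auto simp: leq_def\<close>)
qed (use c3dp_algebra_is_algebra satisfies_c3dp_identities in blast)

section \<open>Transfer along isomorphisms and the generation theorem\<close>

lemma isomorphic_satisfies:
  assumes "isomorphic A B" "satisfies B e"
  shows "satisfies A e"
proof -
  obtain h where inj: "inj_on h (carrier A)" and img: "h ` carrier A = carrier B"
    and hom: "\<And>x y. \<lbrakk>x \<in> carrier A; y \<in> carrier A\<rbrakk> \<Longrightarrow> h (x \<sqinter>\<^bsub>A\<^esub> y) = h x \<sqinter>\<^bsub>B\<^esub> h y"
      "\<And>x y. \<lbrakk>x \<in> carrier A; y \<in> carrier A\<rbrakk> \<Longrightarrow> h (x \<squnion>\<^bsub>A\<^esub> y) = h x \<squnion>\<^bsub>B\<^esub> h y"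
      "\<And>x. x \<in> carrier A \<Longrightarrow> h (\<sim>\<^bsub>A\<^esub> x) = \<sim>\<^bsub>B\<^esub> (h x)"
      "\<And>x. x \<in> carrier A \<Longrightarrow> h (\<D>\<^bsub>A\<^esub> x) = \<D>\<^bsub>B\<^esub> (h x)"
      "h \<zero>\<^bsub>A\<^esub> = \<zero>\<^bsub>B\<^esub>" "h \<c>\<^bsub>A\<^esub> = \<c>\<^bsub>B\<^esub>" "h \<one>\<^bsub>A\<^esub> = \<one>\<^bsub>B\<^esub>"
    using assms(1) unfolding isomorphic_def bij_betw_def by blast
  have alg: "is_algebra A" using assms(1) by (simp add: isomorphic_def)
  show ?thesis
    unfolding satisfies_def
  proof (intro allI impI)
    fix \<rho> :: "nat \<Rightarrow> 'a" assume \<rho>: "\<forall>n. \<rho> n \<in> carrier A"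
    have closed: "trm_val A \<rho> t \<in> carrier A" for t
      using \<rho> alg by (induction t) (simp_all add: is_algebra_def)
    \<comment> \<open>Since \<open>h\<close> commutes with evaluation, an identity of
      \<open>B\<close> equates the images of both sides; injectivity then reflects it to
      \<open>A\<close>.\<close>
    have "h (trm_val A \<rho> t) = trm_val B (h \<circ> \<rho>) t" for t
      by (induction t) (simp_all add: hom closed)
    moreover have "\<forall>n. (h \<circ> \<rho>) n \<in> carrier B"
      using \<rho> img by auto
    ultimately have "h (trm_val A \<rho> (fst e)) = h (trm_val A \<rho> (snd e))"
      using assms(2) by (simp add: satisfies_def)
    then show "trm_val A \<rho> (fst e) = trm_val A \<rho> (snd e)"
      using inj closed by (meson inj_onD)
  qed
qed

text \<open>This is stronger than generation. One inclusion transports the identities back along the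
  isomorphism; the other represents each algebra over its skeleton.\<close>

lemma contract_algebras_eq_C3DP: "contract_algebras = C3DP"
proof (intro equalityI subsetI)
  fix A :: "'a c3dp_sig"
  assume "A \<in> contract_algebras"
  then obtain B :: "'a boolean_sig" where B: "boolean_alg B" "isomorphic A (contract_algebra B)"
    by (auto simp: contract_algebras_def)
  then have "c3dp_algebra (contract_algebra B)"
    by (simp add: c3dp_algebra_contract_algebra)
  moreover have "is_algebra A"
    using B by (simp add: isomorphic_def)
  ultimately show "A \<in> C3DP"
    using isomorphic_satisfies[OF B(2)] by (auto simp: C3DP_def c3dp_algebra_iff_identities)
next
  fix A :: "'a c3dp_sig"
  assume "A \<in> C3DP"
  then show "A \<in> contract_algebras"
    using boolean_alg_skeleton isomorphic_contract_algebra_skeleton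
    by (auto simp: C3DP_def contract_algebras_def)
qed

theorem corollary4p3:
  "variety_generated_by (C3DP :: 'a c3dp_sig set) (contract_algebras :: 'a c3dp_sig set)"
proof -
  have "variety (C3DP :: 'a c3dp_sig set)"
    unfolding variety_def C3DP_def c3dp_algebra_iff_identities by blast
  \<comment> \<open>With the two classes equal, minimality is immediate once \<open>C3DP\<close> is
    known to be a variety.\<close>
  then show ?thesis
    by (simp add: variety_generated_by_def contract_algebras_eq_C3DP)
qed

end
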